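(* Let $\nabla(z)\in\mathbf{Z}[z]$ be the Conway polynomial of a rational (i.e. two-bridge) link or knot. Then there exists a Fibonacci polynomial $f_d(z)$ such that $\nabla(z)\equiv f_d(z) \pmod 2$ (coefficientwise congruence in $\mathbf{Z}[z]$).
   Context: Fibonacci polynomials: $f_0=0$, $f_1=1$, $f_{n+2}(z)=z f_{n+1}(z)+f_n(z)$ for $n\in\mathbf{Z}$. Extended Euler continuant polynomials: for integers $b_1,\dots,b_m$, $D_m(b_1,\dots,b_m)(z)$ is defined by $D_{-1}=0$, $D_0=1$, $D_k=b_k z D_{k-1}+D_{k-2}$; equivalently it is the determinant of the $m\times m$ tridiagonal matrix with diagonal entries $b_1z,\dots,b_mz$, superdiagonal entries $-1$ and subdiagonal entries $1$. Two-bridge (rational) links: for nonzero integers $b_1,\dots,b_m$ ($m\ge 0$), $C(2b_1,-2b_2,\dots,(-1)^{m-1}2b_m)$ denotes the two-bridge link in Conway normal form with these numbers of signed crossings in its successive twist regions (its Schubert fraction is the continued fraction $[2b_1,-2b_2,\dots,(-1)^{m-1}2b_m]$, where $[a_1,\dots,a_n]=a_1+1/(a_2+1/(\cdots+1/a_n))$), oriented so that the two strands of each twist region are antiparallel (it bounds the linear plumbing of $m$ unknotted annuli with $|b_1|,\dots,|b_m|$ full twists). Every oriented two-bridge link is of this form; it is a knot if $m$ is even and a two-component link if $m$ is odd. The Conway polynomial $\nabla_K(z)$ of an oriented link is defined by $\nabla_{\text{unknot}}=1$ and the skein relation $\nabla_{L_+}-\nabla_{L_-}=z\nabla_{L_0}$.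 It is known (Siebenmann; Cromwell) that the Conway polynomial of $C(2b_1,-2b_2,\dots,(-1)^{m-1}2b_m)$ is $D_m(b_1,\dots,b_m)(z)$. *)

theory Defs
  imports "HOL-Computational_Algebra.Polynomial" "HOL-Number_Theory.Cong"
begin

section \<open>Oriented link diagrams\<close>

text \<open>
  A diagram in general position with respect to the height function is cut into slices, each
  containing exactly one minimum, maximum or crossing. A diagram is the list of its slices, read
  from bottom to top. A slice \<open>(i, e)\<close> has the piece \<open>e\<close> standing to the right of exactly \<open>i\<close>
  vertical strands.

  The strands met by a horizontal line between two slices are listed from left to right; an entry
  is \<open>True\<close> if that strand is oriented upwards there, and \<open>False\<close> if it is oriented downwards.

  In \<open>Cup d\<close> (a minimum) the left leg has direction \<open>d\<close>; \<open>Cap\<close> is a maximum. In \<open>Cross True\<close> the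
  strand going from bottom left to top right is the upper one, in \<open>Cross False\<close> it is the lower
  one. Since a closed diagram starts from no strands, the directions of its minima determine the
  orientation of the whole diagram.
\<close>

datatype piece = Cup bool | Cap | Cross bool

type_synonym slice = "nat \<times> piece"
type_synonym diagram = "slice list"

inductive slice_between :: "bool list \<Rightarrow> slice \<Rightarrow> bool list \<Rightarrow> bool" where
  cup: "slice_between (xs @ ys) (length xs, Cup d) (xs @ [d, \<not> d] @ ys)"
| cap: "slice_between (xs @ [d, \<not> d] @ ys) (length xs, Cap) (xs @ ys)"
| cross: "slice_between (xs @ [a, b] @ ys) (length xs, Cross c) (xs @ [b, a] @ ys)"

text \<open>\<open>tangle s w t\<close>: the slices \<open>w\<close> form a coherently oriented tangle diagram with lower boundary
  \<open>s\<close> and upper boundary \<open>t\<close>.\<close>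

inductive tangle :: "bool list \<Rightarrow> diagram \<Rightarrow> bool list \<Rightarrow> bool" where
  empty: "tangle s [] s"
| slice: "slice_between s x t \<Longrightarrow> tangle t w u \<Longrightarrow> tangle s (x # w) u"

definition link_diagram :: "diagram \<Rightarrow> bool" where
  "link_diagram w \<longleftrightarrow> tangle [] w []"


section \<open>Isotopy of oriented links\<close>

fun lower_ends :: "piece \<Rightarrow> nat" where
  "lower_ends (Cup d) = 0"
| "lower_ends Cap = 2"
| "lower_ends (Cross c) = 2"

fun upper_ends :: "piece \<Rightarrow> nat" where
  "upper_ends (Cup d) = 2"
| "upper_ends Cap = 0"
| "upper_ends (Cross c) = 2"

text \<open>
  Two oriented links are ambient isotopic iff their sliced diagrams are related by the following
  moves (Reidemeister's theorem for diagrams sliced by height; Turaev, Freyd and Yetter). Exchange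
  of distant pieces, zigzags and the slides of a crossing past a minimum or a maximum account for
  planar isotopy (the slides also turn crossings around); the others are the three Reidemeister
  moves. Every compatible orientation is allowed: compatibility is imposed in \<open>isotopic\<close>.
\<close>

inductive local_move :: "diagram \<Rightarrow> diagram \<Rightarrow> bool" where
  exchange: "i \<le> k \<Longrightarrow>
    local_move [(i, x), (k + upper_ends x, y)] [(k + lower_ends x, y), (i, x)]"
| zigzag_left: "local_move [(Suc i, Cup d), (i, Cap)] []"
| zigzag_right: "local_move [(i, Cup d), (Suc i, Cap)] []"
| slide_cup: "local_move [(i, Cup d), (Suc i, Cross c)] [(Suc i, Cup d), (i, Cross (\<not> c))]"
| slide_cap: "local_move [(Suc i, Cross c), (i, Cap)] [(i, Cross (\<not> c)), (Suc i, Cap)]"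
| reidemeister1_cup: "local_move [(i, Cup d), (i, Cross c)] [(i, Cup (\<not> d))]"
| reidemeister1_cap: "local_move [(i, Cross c), (i, Cap)] [(i, Cap)]"
| reidemeister2: "local_move [(i, Cross c), (i, Cross (\<not> c))] []"
| reidemeister3: "local_move [(i, Cross c), (Suc i, Cross c), (i, Cross c)]
    [(Suc i, Cross c), (i, Cross c), (Suc i, Cross c)]"

inductive isotopic :: "diagram \<Rightarrow> diagram \<Rightarrow> bool" where
  refl: "link_diagram w \<Longrightarrow> isotopic w w"
| move: "tangle [] u s \<Longrightarrow> local_move l r \<Longrightarrow> tangle s l t \<Longrightarrow> tangle s r t \<Longrightarrow> tangle t v [] \<Longrightarrow>
    isotopic (u @ l @ v) (u @ r @ v)"
| sym: "isotopic w w' \<Longrightarrow> isotopic w' w"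
| trans: "isotopic w w' \<Longrightarrow> isotopic w' w'' \<Longrightarrow> isotopic w w''"


section \<open>The Conway polynomial\<close>

text \<open>
  A crossing with both strands pointing upwards (or both downwards) is positive iff the upper strand
  goes from bottom left to top right; reversing one of the two strands changes the sign.
  The smoothing compatible with the orientation is the pair of vertical strands if the strands are
  both upwards or both downwards, and a maximum below a minimum otherwise.
\<close>

inductive skein_triple :: "diagram \<Rightarrow> diagram \<Rightarrow> diagram \<Rightarrow> bool" where
  "tangle [] u (xs @ [a, b] @ ys) \<Longrightarrow> tangle (xs @ [b, a] @ ys) v [] \<Longrightarrow> i = length xs \<Longrightarrow>
   skein_triple
     (u @ [(i, Cross (a = b))] @ v)
     (u @ [(i, Cross (a \<noteq> b))] @ v)
     (u @ (if a = b then [] else [(i, Cap), (i, Cup b)]) @ v)"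

definition unknot :: diagram where
  "unknot = [(0, Cup True), (0, Cap)]"

text \<open>The three axioms determine the value on every diagram of a nonempty link.\<close>

definition is_conway_polynomial :: "(diagram \<Rightarrow> int poly) \<Rightarrow> bool" where
  "is_conway_polynomial conway \<longleftrightarrow>
     (\<forall>L L'. isotopic L L' \<longrightarrow> conway L = conway L') \<and>
     conway unknot = 1 \<and>
     (\<forall>Lp Lm L0. skein_triple Lp Lm L0 \<longrightarrow> conway Lp - conway Lm = [:0, 1:] * conway L0)"


section \<open>Two-bridge links\<close>

text \<open>
  Two-bridge links in arbitrary orientation, presented as 4-plats: two minima, a braid on four
  strands, two maxima. This contains all Conway normal forms \<open>C(a\<^sub>1, \<dots>, a\<^sub>n)\<close>, with \<open>a\<^sub>j\<close> of any
  parity and the strands of a twist region parallel or antiparallel: the braid is the product of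
  powers with exponents \<open>\<plusminus> a\<^sub>j\<close> of alternately the middle and the first generator. (If \<open>n\<close> is even,
  the normal form is closed by nested maxima \<open>[(1, Cap), (0, Cap)]\<close>, which can be replaced by
  \<open>[(0, Cross c), (1, Cross c), (0, Cap), (0, Cap)]\<close> by \<open>slide_cap\<close> and \<open>reidemeister2\<close>.)
\<close>

definition four_plat :: "bool \<Rightarrow> bool \<Rightarrow> (nat \<times> bool) list \<Rightarrow> diagram" where
  "four_plat d e braid =
     [(0, Cup d), (2, Cup e)] @ map (\<lambda>(i, c). (i, Cross c)) braid @ [(0, Cap), (0, Cap)]"

definition two_bridge :: "diagram \<Rightarrow> bool" where
  "two_bridge L \<longleftrightarrow>
     (\<exists>d e braid. (\<forall>(i, c) \<in> set braid. i < 3) \<and> isotopic L (four_plat d e braid))"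


section \<open>Fibonacci polynomials\<close>

fun fib_poly_nat :: "nat \<Rightarrow> int poly" where
  "fib_poly_nat 0 = 0"
| "fib_poly_nat (Suc 0) = 1"
| "fib_poly_nat (Suc (Suc n)) = [:0, 1:] * fib_poly_nat (Suc n) + fib_poly_nat n"

definition fib_poly :: "int \<Rightarrow> int poly" where
  "fib_poly n =
     (if 0 \<le> n then fib_poly_nat (nat n) else (- 1) ^ nat (1 - n) * fib_poly_nat (nat (- n)))"

text \<open>The closed form for negative indices is the one forced by the recursion.\<close>

lemma fib_poly_rec: "fib_poly (n + 2) = [:0, 1:] * fib_poly (n + 1) + fib_poly n"
proof -
  consider (nonneg) m where "n = int m" | (minus1) "n = - 1" | (neg) m where "n = - int m - 2"
  proof (cases "0 \<le> n")
    case True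
    then show ?thesis using that(1)[of "nat n"] by simp
  next
    case False
    then show ?thesis using that(2) that(3)[of "nat (- n - 2)"] by fastforce
  qed
  then show ?thesis
  proof cases
    case nonneg
    then have "nat (n + 2) = Suc (Suc m)" "nat (n + 1) = Suc m" "nat n = m" by auto
    then show ?thesis using nonneg by (simp add: fib_poly_def)
  next
    case minus1
    then show ?thesis by (simp add: fib_poly_def)
  next
    case neg
    show ?thesis
    proof (cases m)
      case 0
      then show ?thesis using neg by (simp add: fib_poly_def numeral_2_eq_2 numeral_3_eq_3)
    next
      case (Suc k)
      have e: "nat (- n) = Suc (Suc m)" "nat (- (n + 1)) = Suc m" "nat (- (n + 2)) = m"
        "nat (1 - n) = Suc (Suc (Suc m))" "nat (1 - (n + 1)) = Suc (Suc m)"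
        "nat (1 - (n + 2)) = Suc m"
        using neg by auto
      have "\<not> 0 \<le> n" "\<not> 0 \<le> n + 1" "\<not> 0 \<le> n + 2" using neg Suc by auto
      then show ?thesis unfolding fib_poly_def e by (simp add: algebra_simps)
    qed
  qed
qed

lemma fib_poly_0: "fib_poly 0 = 0" and fib_poly_1: "fib_poly 1 = 1"
  by (simp_all add: fib_poly_def)

end

theory Submission
  imports Defs
begin

text \<open>
  The proof follows a 4-plat upwards, one crossing at a time, and keeps track of all the ways in
  which the part below can be closed. There are three ways to join four ends in pairs: neighbouring
  ends by two maxima side by side (\<open>adjacent_caps\<close>), by two nested maxima (\<open>nested_caps\<close>), or, with
  one crossing, each end with the next but one (\<open>crossed_caps\<close>). Two of the four ends point upwards
  and two downwards, so exactly two of the three closures are compatible with the orientation.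

  The invariant (\<open>fibonacci_tangle\<close>) is that the Conway polynomials of the two compatible closures
  are, modulo 2, two consecutive Fibonacci polynomials \<open>f\<^sub>j\<close> and \<open>f\<^sub>j\<^sub>+\<^sub>1\<close>, where \<open>j\<close> is an integer.
  Since \<open>f\<^sub>-\<^sub>n\<close> and \<open>f\<^sub>n\<close> agree modulo 2, the order of the two does not matter.

  A crossing placed on top of the tangle permutes the three closures: it fixes one of them and
  exchanges the other two, up to the sign of the crossing in \<open>crossed_caps\<close>. That sign does not
  matter either. Up to isotopy, the crossing is between parallel strands and its smoothing is the
  other compatible closure, so changing the sign turns \<open>f\<^sub>j\<^sub>+\<^sub>1\<close> into \<open>f\<^sub>j\<^sub>+\<^sub>1 \<plusminus> z f\<^sub>j\<close>, which is \<open>f\<^sub>j\<^sub>-\<^sub>1\<close> modulo 2. Hence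
  the invariant passes from a tangle to the tangle with one more crossing (\<open>fibonacci_tangle_cross\<close>).
  It holds for two minima alone, whose closures are a two-component unlink and an unknot, with
  polynomials \<open>f\<^sub>0\<close> and \<open>f\<^sub>1\<close>.
\<close>

section \<open>Consecutive Fibonacci polynomials modulo 2\<close>

lemma fib_poly_minus_mod2: "2 dvd fib_poly (- n) - fib_poly n"
proof -
  have neg: "2 dvd fib_poly (- int m) - fib_poly (int m)" for m
  proof (cases "even (Suc m)")
    case True
    then show ?thesis by (cases "m = 0") (auto simp: fib_poly_def nat_add_distrib)
  next
    case False
    then have "fib_poly (- int m) - fib_poly (int m) = 2 * (- fib_poly (int m))"
      by (cases "m = 0") (auto simp: fib_poly_def nat_add_distrib)
    then show ?thesis by (metis dvd_triv_left)
  qed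
  show ?thesis
  proof (cases "0 \<le> n")
    case True
    then show ?thesis using neg[of "nat n"] by simp
  next
    case False
    then have "2 dvd fib_poly n - fib_poly (- n)" using neg[of "nat (- n)"] by simp
    then show ?thesis by (metis dvd_minus_iff minus_diff_eq)
  qed
qed

definition fib_consecutive :: "int poly \<Rightarrow> int poly \<Rightarrow> bool" where
  "fib_consecutive p q \<longleftrightarrow> (\<exists>j. 2 dvd p - fib_poly j \<and> 2 dvd q - fib_poly (j + 1))"

lemma fib_consecutive_0_1: "fib_consecutive 0 1"
  unfolding fib_consecutive_def by (rule exI[of _ 0]) (simp add: fib_poly_0 fib_poly_1)

text \<open>Negating the indices turns \<open>(f\<^sub>j\<^sub>+\<^sub>1, f\<^sub>j)\<close> into \<open>(f\<^sub>-\<^sub>j\<^sub>-\<^sub>1, f\<^sub>-\<^sub>j)\<close>.\<close>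

lemma fib_consecutive_sym:
  assumes "fib_consecutive p q"
  shows "fib_consecutive q p"
proof -
  obtain j where j: "2 dvd p - fib_poly j" "2 dvd q - fib_poly (j + 1)"
    using assms unfolding fib_consecutive_def by blast
  have "2 dvd (q - fib_poly (j + 1)) - (fib_poly (- (j + 1)) - fib_poly (j + 1))"
    using j(2) fib_poly_minus_mod2 by (rule dvd_diff)
  moreover have "2 dvd (p - fib_poly j) - (fib_poly (- j) - fib_poly j)"
    using j(1) fib_poly_minus_mod2 by (rule dvd_diff)
  ultimately show ?thesis
    unfolding fib_consecutive_def by (intro exI[of _ "- (j + 1)"]) simp
qed

text \<open>The recursion, read as a reflection: \<open>f\<^sub>j\<close> has the two neighbours \<open>f\<^sub>j\<^sub>-\<^sub>1\<close> and \<open>f\<^sub>j\<^sub>+\<^sub>1\<close>, whose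
  difference is \<open>z f\<^sub>j\<close>.\<close>

lemma fib_consecutive_reflect:
  assumes "fib_consecutive p q"
    and "q - q' = [:0, 1:] * p \<or> q' - q = [:0, 1:] * p"
  shows "fib_consecutive p q'"
proof -
  obtain j where j: "2 dvd p - fib_poly j" "2 dvd q - fib_poly (j + 1)"
    using assms(1) unfolding fib_consecutive_def by blast
  have rec: "fib_poly (j + 1) = [:0, 1:] * fib_poly j + fib_poly (j - 1)"
    using fib_poly_rec[of "j - 1"] by (simp add: algebra_simps)
  have "2 dvd q' - (q - [:0, 1:] * p)"
    using assms(2)
  proof
    assume "q - q' = [:0, 1:] * p"
    then have "q' - (q - [:0, 1:] * p) = 0" by algebra
    then show ?thesis by simp
  next
    assume "q' - q = [:0, 1:] * p"
    then have "q' - (q - [:0, 1:] * p) = 2 * ([:0, 1:] * p)" by algebra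
    then show ?thesis by (metis dvd_triv_left)
  qed
  moreover have "2 dvd (q - fib_poly (j + 1)) - [:0, 1:] * (p - fib_poly j)"
    by (rule dvd_diff[OF j(2) dvd_mult[OF j(1)]])
  ultimately have "2 dvd (q' - (q - [:0, 1:] * p)) +
      ((q - fib_poly (j + 1)) - [:0, 1:] * (p - fib_poly j))"
    by (rule dvd_add)
  moreover have "(q' - (q - [:0, 1:] * p)) +
      ((q - fib_poly (j + 1)) - [:0, 1:] * (p - fib_poly j)) = q' - fib_poly (j - 1)"
    unfolding rec by algebra
  ultimately have "fib_consecutive q' p"
    unfolding fib_consecutive_def using j(1) by (intro exI[of _ "j - 1"]) simp
  then show ?thesis by (rule fib_consecutive_sym)
qed


section \<open>Oriented tangles\<close>

text \<open>The next four lemmas decide \<open>slice_between\<close> by simplification when the lower boundary and the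
  position are given explicitly.\<close>

lemma slice_between_Suc [simp]:
  "slice_between (a # s) (Suc i, x) t \<longleftrightarrow> (\<exists>t'. t = a # t' \<and> slice_between s (i, x) t')"
proof
  assume "slice_between (a # s) (Suc i, x) t"
  then show "\<exists>t'. t = a # t' \<and> slice_between s (i, x) t'"
  proof cases
    case (cup xs ys d)
    then show ?thesis by (cases xs) (auto intro: slice_between.cup[simplified])
  next
    case (cap xs d ys)
    then show ?thesis by (cases xs) (auto intro: slice_between.cap[simplified])
  next
    case (cross xs b b' ys c)
    then show ?thesis by (cases xs) (auto intro: slice_between.cross[simplified])
  qed
next
  assume "\<exists>t'. t = a # t' \<and> slice_between s (i, x) t'"
  then obtain t' where t: "t = a # t'" and "slice_between s (i, x) t'" by blast
  from this(2) show "slice_between (a # s) (Suc i, x) t"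
  proof cases
    case (cup xs ys d)
    then show ?thesis using t slice_between.cup[of "a # xs" ys d] by simp
  next
    case (cap xs d ys)
    then show ?thesis using t slice_between.cap[of "a # xs" d ys] by simp
  next
    case (cross xs b b' ys c)
    then show ?thesis using t slice_between.cross[of "a # xs" b b' ys c] by simp
  qed
qed

lemma slice_between_cup_0 [simp]: "slice_between s (0, Cup d) t \<longleftrightarrow> t = d # (\<not> d) # s"
  using slice_between.cup[of "[]" s d] by (auto elim: slice_between.cases)

lemma slice_between_cap_0 [simp]:
  "slice_between (a # b # s) (0, Cap) t \<longleftrightarrow> b = (\<not> a) \<and> t = s"
  using slice_between.cap[of "[]" a s] by (auto elim: slice_between.cases)

lemma slice_between_cross_0 [simp]:
  "slice_between (a # b # s) (0, Cross c) t \<longleftrightarrow> t = b # a # s"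
  using slice_between.cross[of "[]" a b s c] by (auto elim: slice_between.cases)

lemma tangle_Nil [simp]: "tangle s [] t \<longleftrightarrow> s = t"
  by (auto intro: tangle.empty elim: tangle.cases)

lemma tangle_Cons [simp]: "tangle s (x # w) u \<longleftrightarrow> (\<exists>t. slice_between s x t \<and> tangle t w u)"
  by (auto intro: tangle.slice elim: tangle.cases)

lemma tangle_append [simp]: "tangle s (v @ w) u \<longleftrightarrow> (\<exists>t. tangle s v t \<and> tangle t w u)"
  by (induction v arbitrary: s) auto

lemma slice_between_unique: "slice_between s x t \<Longrightarrow> slice_between s x t' \<Longrightarrow> t = t'"
  by (induction rule: slice_between.induct) (auto elim!: slice_between.cases)

lemma tangle_unique: "tangle s w t \<Longrightarrow> tangle s w t' \<Longrightarrow> t = t'"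
  by (induction w arbitrary: s) (auto dest: slice_between_unique)

lemma isotopic_link_diagram:
  "isotopic w w' \<Longrightarrow> link_diagram w \<and> link_diagram w'"
  by (induction rule: isotopic.induct) (auto simp: link_diagram_def)


section \<open>Closures of four ends\<close>

text \<open>Quantifying over the tangle below makes this relation a congruence for adding slices at the
  bottom, so that closures can be simplified independently of what they close.\<close>

definition isotopic_closures :: "bool list \<Rightarrow> diagram \<Rightarrow> diagram \<Rightarrow> bool" where
  "isotopic_closures s v w \<longleftrightarrow> (\<forall>u. tangle [] u s \<longrightarrow> isotopic (u @ v) (u @ w))"

lemma isotopic_closures_sym: "isotopic_closures s v w \<Longrightarrow> isotopic_closures s w v"
  unfolding isotopic_closures_def by (blast intro: isotopic.sym)

lemma isotopic_closures_trans [trans]: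
  "isotopic_closures s v w \<Longrightarrow> isotopic_closures s w x \<Longrightarrow> isotopic_closures s v x"
  unfolding isotopic_closures_def by (blast intro: isotopic.trans)

lemma isotopic_closures_move:
  "local_move l r \<Longrightarrow> tangle s l t \<Longrightarrow> tangle s r t \<Longrightarrow> tangle t v [] \<Longrightarrow>
    isotopic_closures s (l @ v) (r @ v)"
  unfolding isotopic_closures_def by (blast intro: isotopic.move)

lemma isotopic_closures_Cons:
  assumes "isotopic_closures t v w" "slice_between s x t"
  shows "isotopic_closures s (x # v) (x # w)"
  unfolding isotopic_closures_def
proof (intro allI impI)
  fix u assume "tangle [] u s"
  with assms(2) have "tangle [] (u @ [x]) t" by auto
  then show "isotopic (u @ x # v) (u @ x # w)"
    using assms(1) unfolding isotopic_closures_def by fastforce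
qed

lemma isotopic_closures_cancel:
  "tangle s [(i, Cross c), (i, Cross (\<not> c))] s \<Longrightarrow> tangle s v [] \<Longrightarrow>
    isotopic_closures s ((i, Cross c) # (i, Cross (\<not> c)) # v) v"
  using isotopic_closures_move[OF reidemeister2, of s i c s v] by simp

definition adjacent_caps :: diagram where
  "adjacent_caps = [(0, Cap), (0, Cap)]"

definition nested_caps :: diagram where
  "nested_caps = [(1, Cap), (0, Cap)]"

definition crossed_caps :: "bool \<Rightarrow> diagram" where
  "crossed_caps c = (1, Cross c) # adjacent_caps"

lemmas caps_defs = adjacent_caps_def nested_caps_def crossed_caps_def

lemma cross0_adjacent:
  "isotopic_closures [a, \<not> a, b, \<not> b] ((0, Cross c) # adjacent_caps) adjacent_caps"
  using isotopic_closures_move[OF reidemeister1_cap, of "[a, \<not> a, b, \<not> b]" 0 c "[b, \<not> b]" "[(0, Cap)]"]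
  by (simp add: caps_defs)

text \<open>By an exchange, either maximum of \<open>adjacent_caps\<close> may be taken as the lower one.\<close>

lemma adjacent_caps_exchange:
  "isotopic_closures [a, \<not> a, b, \<not> b] adjacent_caps [(2, Cap), (0, Cap)]"
  using isotopic_closures_move[OF exchange[of 0 0 Cap Cap], of "[a, \<not> a, b, \<not> b]" "[]" "[]"]
  by (simp add: caps_defs numeral_2_eq_2)

lemma cross2_adjacent:
  "isotopic_closures [a, \<not> a, b, \<not> b] ((2, Cross c) # adjacent_caps) adjacent_caps"
proof -
  have "isotopic_closures [a, \<not> a, b, \<not> b] ((2, Cross c) # adjacent_caps)
      [(2, Cross c), (2, Cap), (0, Cap)]"
    using adjacent_caps_exchange[of a "\<not> b"]
    by (rule isotopic_closures_Cons) (simp add: numeral_2_eq_2)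
  also have "isotopic_closures [a, \<not> a, b, \<not> b] [(2, Cross c), (2, Cap), (0, Cap)]
      [(2, Cap), (0, Cap)]"
    using isotopic_closures_move[OF reidemeister1_cap, of "[a, \<not> a, b, \<not> b]" 2 c "[a, \<not> a]" "[(0, Cap)]"]
    by (simp add: numeral_2_eq_2)
  also have "isotopic_closures [a, \<not> a, b, \<not> b] [(2, Cap), (0, Cap)] adjacent_caps"
    by (rule isotopic_closures_sym[OF adjacent_caps_exchange])
  finally show ?thesis .
qed

lemma cross1_nested:
  "isotopic_closures [a, b, \<not> b, \<not> a] ((1, Cross c) # nested_caps) nested_caps"
  using isotopic_closures_move[OF reidemeister1_cap, of "[a, b, \<not> b, \<not> a]" 1 c "[a, \<not> a]" "[(0, Cap)]"]
  by (simp add: caps_defs)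

text \<open>Sliding the crossing over a maximum presents \<open>crossed_caps\<close> as a twist of \<open>nested_caps\<close>, either
  of the left two ends or of the right two.\<close>

lemma cross0_nested:
  "isotopic_closures [a, b, \<not> a, \<not> b] ((0, Cross c) # nested_caps) (crossed_caps (\<not> c))"
  by (rule isotopic_closures_sym)
    (use isotopic_closures_move[OF slide_cap, of "[a, b, \<not> a, \<not> b]" 0 "\<not> c" "[b, \<not> b]" "[(0, Cap)]"]
      in \<open>simp add: caps_defs\<close>)

lemma cross2_nested:
  "isotopic_closures [a, b, \<not> a, \<not> b] ((2, Cross c) # nested_caps) (crossed_caps (\<not> c))"
proof -
  have "isotopic_closures [a, b, \<not> a, \<not> b] ((2, Cross c) # nested_caps)
      [(1, Cross (\<not> c)), (2, Cap), (0, Cap)]"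
    using isotopic_closures_move[OF slide_cap, of "[a, b, \<not> a, \<not> b]" 1 c "[a, \<not> a]" "[(0, Cap)]"]
    by (simp add: caps_defs numeral_2_eq_2)
  also have "isotopic_closures [a, b, \<not> a, \<not> b] [(1, Cross (\<not> c)), (2, Cap), (0, Cap)]
      (crossed_caps (\<not> c))"
    unfolding crossed_caps_def
    using isotopic_closures_sym[OF adjacent_caps_exchange[of a b]]
    by (rule isotopic_closures_Cons) simp
  finally show ?thesis .
qed

text \<open>In each of the next three lemmas, the lowest crossing cancels the one in \<open>crossed_caps\<close>, presented
  as a twist of the same two ends.\<close>

lemma cross0_crossed:
  "isotopic_closures [a, b, \<not> b, \<not> a] ((0, Cross c) # crossed_caps c) nested_caps"
proof -
  have "isotopic_closures [a, b, \<not> b, \<not> a] ((0, Cross c) # crossed_caps c)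
      ((0, Cross c) # (0, Cross (\<not> c)) # nested_caps)"
    using isotopic_closures_sym[OF cross0_nested[of b a "\<not> c"]]
    by (intro isotopic_closures_Cons) auto
  also have "isotopic_closures [a, b, \<not> b, \<not> a]
      ((0, Cross c) # (0, Cross (\<not> c)) # nested_caps) nested_caps"
    by (rule isotopic_closures_cancel) (simp_all add: caps_defs)
  finally show ?thesis .
qed

lemma cross2_crossed:
  "isotopic_closures [a, b, \<not> b, \<not> a] ((2, Cross c) # crossed_caps c) nested_caps"
proof -
  have "isotopic_closures [a, b, \<not> b, \<not> a] ((2, Cross c) # crossed_caps c)
      ((2, Cross c) # (2, Cross (\<not> c)) # nested_caps)"
    using isotopic_closures_sym[OF cross2_nested[of a b "\<not> c"]]
    by (intro isotopic_closures_Cons) (auto simp: numeral_2_eq_2)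
  also have "isotopic_closures [a, b, \<not> b, \<not> a]
      ((2, Cross c) # (2, Cross (\<not> c)) # nested_caps) nested_caps"
    by (rule isotopic_closures_cancel) (simp_all add: caps_defs numeral_2_eq_2)
  finally show ?thesis .
qed

lemma cross1_crossed:
  "isotopic_closures [a, \<not> a, b, \<not> b] ((1, Cross c) # crossed_caps (\<not> c)) adjacent_caps"
  unfolding crossed_caps_def
  by (rule isotopic_closures_cancel) (simp_all add: caps_defs)


section \<open>The invariant\<close>

text \<open>The three disjuncts are the possible positions of the two upward ends up to reversal of all
  strands, each with the two closures that it admits.\<close>

definition fibonacci_tangle :: "(diagram \<Rightarrow> int poly) \<Rightarrow> diagram \<Rightarrow> bool" where
  "fibonacci_tangle conway u \<longleftrightarrow> (\<exists>a.
     tangle [] u [a, \<not> a, a, \<not> a] \<and>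
       fib_consecutive (conway (u @ adjacent_caps)) (conway (u @ nested_caps)) \<or>
     tangle [] u [a, \<not> a, \<not> a, a] \<and>
       (\<forall>c. fib_consecutive (conway (u @ adjacent_caps)) (conway (u @ crossed_caps c))) \<or>
     tangle [] u [a, a, \<not> a, \<not> a] \<and>
       (\<forall>c. fib_consecutive (conway (u @ nested_caps)) (conway (u @ crossed_caps c))))"

context
  fixes conway :: "diagram \<Rightarrow> int poly"
  assumes conway: "is_conway_polynomial conway"
begin

lemma conway_isotopic: "isotopic L L' \<Longrightarrow> conway L = conway L'"
  using conway unfolding is_conway_polynomial_def by blast

lemma conway_closures:
  "isotopic_closures s v w \<Longrightarrow> tangle [] u s \<Longrightarrow> conway (u @ v) = conway (u @ w)"
  unfolding isotopic_closures_def by (blast intro: conway_isotopic)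

lemma conway_parallel_crossing:
  assumes "tangle [] u (xs @ [b, b] @ ys)" "tangle (xs @ [b, b] @ ys) v []"
  shows "conway (u @ (length xs, Cross True) # v) - conway (u @ (length xs, Cross False) # v)
    = [:0, 1:] * conway (u @ v)"
proof -
  have "skein_triple (u @ [(length xs, Cross (b = b))] @ v) (u @ [(length xs, Cross (b \<noteq> b))] @ v)
      (u @ (if b = b then [] else [(length xs, Cap), (length xs, Cup b)]) @ v)"
    by (rule skein_triple.intros[OF assms HOL.refl])
  then show ?thesis
    using conway unfolding is_conway_polynomial_def by fastforce
qed

text \<open>The sign of a crossing between parallel strands does not affect the invariant, because the
  values for the two signs are the two neighbours of the value for the smoothing.\<close>

lemma fib_consecutive_all_signs:
  assumes "tangle [] u (xs @ [b, b] @ ys)" "tangle (xs @ [b, b] @ ys) v []"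
    and "fib_consecutive (conway (u @ v)) (conway (u @ (length xs, Cross c) # v))"
  shows "fib_consecutive (conway (u @ v)) (conway (u @ (length xs, Cross c') # v))"
proof (cases "c' = c")
  case True
  then show ?thesis using assms(3) by simp
next
  case False
  with conway_parallel_crossing[OF assms(1,2)] show ?thesis
    by (intro fib_consecutive_reflect[OF assms(3)]) (cases c; cases c'; simp)
qed

lemma fibonacci_tangleI1:
  assumes "tangle [] u [a, \<not> a, a, \<not> a]"
    and "fib_consecutive (conway (u @ adjacent_caps)) (conway (u @ nested_caps))"
  shows "fibonacci_tangle conway u"
  using assms unfolding fibonacci_tangle_def by blast

lemma fibonacci_tangleI2:
  assumes t: "tangle [] u [a, \<not> a, \<not> a, a]"
    and f: "fib_consecutive (conway (u @ adjacent_caps)) (conway (u @ crossed_caps c))"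
  shows "fibonacci_tangle conway u"
proof -
  have "fib_consecutive (conway (u @ adjacent_caps)) (conway (u @ crossed_caps c'))" for c'
    using fib_consecutive_all_signs[of u "[a]" "\<not> a" "[a]" adjacent_caps c c'] t f
    by (simp add: caps_defs)
  then show ?thesis using t unfolding fibonacci_tangle_def by blast
qed

text \<open>Here the crossing of \<open>crossed_caps\<close> is between antiparallel strands; it becomes a crossing of
  the two parallel left strands after the slide of \<open>cross0_nested\<close>.\<close>

lemma fibonacci_tangleI3:
  assumes t: "tangle [] u [a, a, \<not> a, \<not> a]"
    and f: "fib_consecutive (conway (u @ nested_caps)) (conway (u @ crossed_caps c))"
  shows "fibonacci_tangle conway u"
proof -
  have twist: "conway (u @ (0, Cross (\<not> c')) # nested_caps) = conway (u @ crossed_caps c')" for c'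
    using conway_closures[OF cross0_nested[of a a "\<not> c'"] t] by simp
  have "fib_consecutive (conway (u @ nested_caps)) (conway (u @ crossed_caps c'))" for c'
    using fib_consecutive_all_signs[of u "[]" a "[\<not> a, \<not> a]" nested_caps "\<not> c" "\<not> c'"] t f
    unfolding twist[symmetric] by (simp add: caps_defs)
  then show ?thesis using t unfolding fibonacci_tangle_def by blast
qed

text \<open>In each case, the two closures of the new tangle are, by the isotopies above, the two closures
  of the old one; the sign in \<open>crossed_caps\<close> is chosen so that the new crossing cancels.\<close>

lemma fibonacci_tangle_cross:
  assumes "fibonacci_tangle conway u" and "i < 3"
  shows "fibonacci_tangle conway (u @ [(i, Cross c)])"
proof -
  consider (first) "i = 0" | (middle) "i = 1" | (last) "i = 2"
    using assms(2) by linarith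
  note position = this
  have move: "conway ((u @ [(i, Cross c)]) @ v) = conway (u @ w)"
    if "isotopic_closures s ((i, Cross c) # v) w" "tangle [] u s" for s v w
    using conway_closures[OF that] by simp
  obtain a where
    "tangle [] u [a, \<not> a, a, \<not> a] \<and>
       fib_consecutive (conway (u @ adjacent_caps)) (conway (u @ nested_caps)) \<or>
     tangle [] u [a, \<not> a, \<not> a, a] \<and>
       (\<forall>c. fib_consecutive (conway (u @ adjacent_caps)) (conway (u @ crossed_caps c))) \<or>
     tangle [] u [a, a, \<not> a, \<not> a] \<and>
       (\<forall>c. fib_consecutive (conway (u @ nested_caps)) (conway (u @ crossed_caps c)))"
    using assms(1) unfolding fibonacci_tangle_def by blast
  then consider
    (adjacent_nested) "tangle [] u [a, \<not> a, a, \<not> a]"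
      "fib_consecutive (conway (u @ adjacent_caps)) (conway (u @ nested_caps))"
  | (adjacent_crossed) "tangle [] u [a, \<not> a, \<not> a, a]"
      "\<And>c. fib_consecutive (conway (u @ adjacent_caps)) (conway (u @ crossed_caps c))"
  | (nested_crossed) "tangle [] u [a, a, \<not> a, \<not> a]"
      "\<And>c. fib_consecutive (conway (u @ nested_caps)) (conway (u @ crossed_caps c))"
    by blast
  then show ?thesis
  proof cases
    case adjacent_nested
    from position show ?thesis
    proof cases
      case first
      show ?thesis
      proof (rule fibonacci_tangleI2)
        show "tangle [] (u @ [(i, Cross c)]) [\<not> a, \<not> \<not> a, \<not> \<not> a, \<not> a]"
          using adjacent_nested(1) first by auto
        show "fib_consecutive (conway ((u @ [(i, Cross c)]) @ adjacent_caps))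
            (conway ((u @ [(i, Cross c)]) @ crossed_caps c))"
          using adjacent_nested first move[OF _ adjacent_nested(1)]
            cross0_adjacent[of a a c] cross0_crossed[of a "\<not> a" c] by simp
      qed
    next
      case middle
      show ?thesis
      proof (rule fibonacci_tangleI3)
        show "tangle [] (u @ [(i, Cross c)]) [a, a, \<not> a, \<not> a]"
          using adjacent_nested(1) middle by auto
        show "fib_consecutive (conway ((u @ [(i, Cross c)]) @ nested_caps))
            (conway ((u @ [(i, Cross c)]) @ crossed_caps (\<not> c)))"
          using fib_consecutive_sym[OF adjacent_nested(2)] middle move[OF _ adjacent_nested(1)]
            cross1_nested[of a "\<not> a" c] cross1_crossed[of a a c] by simp
      qed
    next
      case last
      show ?thesis
      proof (rule fibonacci_tangleI2)
        show "tangle [] (u @ [(i, Cross c)]) [a, \<not> a, \<not> a, a]"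
          using adjacent_nested(1) last by (auto simp: numeral_2_eq_2)
        show "fib_consecutive (conway ((u @ [(i, Cross c)]) @ adjacent_caps))
            (conway ((u @ [(i, Cross c)]) @ crossed_caps c))"
          using adjacent_nested last move[OF _ adjacent_nested(1)]
            cross2_adjacent[of a a c] cross2_crossed[of a "\<not> a" c] by simp
      qed
    qed
  next
    case adjacent_crossed
    from position show ?thesis
    proof cases
      case first
      show ?thesis
      proof (rule fibonacci_tangleI1)
        show "tangle [] (u @ [(i, Cross c)]) [\<not> a, \<not> \<not> a, \<not> a, \<not> \<not> a]"
          using adjacent_crossed(1) first by auto
        show "fib_consecutive (conway ((u @ [(i, Cross c)]) @ adjacent_caps))
            (conway ((u @ [(i, Cross c)]) @ nested_caps))"
          using adjacent_crossed first move[OF _ adjacent_crossed(1)]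
            cross0_adjacent[of a "\<not> a" c] cross0_nested[of a "\<not> a" c] by simp
      qed
    next
      case middle
      show ?thesis
      proof (rule fibonacci_tangleI2)
        show "tangle [] (u @ [(i, Cross c)]) [a, \<not> a, \<not> a, a]"
          using adjacent_crossed(1) middle by auto
        have "conway ((u @ [(i, Cross c)]) @ adjacent_caps) = conway (u @ crossed_caps c)"
          using middle by (simp add: crossed_caps_def)
        then show "fib_consecutive (conway ((u @ [(i, Cross c)]) @ adjacent_caps))
            (conway ((u @ [(i, Cross c)]) @ crossed_caps (\<not> c)))"
          using fib_consecutive_sym[OF adjacent_crossed(2)[of c]] middle
            move[OF _ adjacent_crossed(1)] cross1_crossed[of a "\<not> a" c] by simp
      qed
    next
      case last
      show ?thesis
      proof (rule fibonacci_tangleI1)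
        show "tangle [] (u @ [(i, Cross c)]) [a, \<not> a, a, \<not> a]"
          using adjacent_crossed(1) last by (auto simp: numeral_2_eq_2)
        show "fib_consecutive (conway ((u @ [(i, Cross c)]) @ adjacent_caps))
            (conway ((u @ [(i, Cross c)]) @ nested_caps))"
          using adjacent_crossed last move[OF _ adjacent_crossed(1)]
            cross2_adjacent[of a "\<not> a" c] cross2_nested[of a "\<not> a" c] by simp
      qed
    qed
  next
    case nested_crossed
    from position show ?thesis
    proof cases
      case first
      show ?thesis
      proof (rule fibonacci_tangleI3)
        show "tangle [] (u @ [(i, Cross c)]) [a, a, \<not> a, \<not> a]"
          using nested_crossed(1) first by auto
        show "fib_consecutive (conway ((u @ [(i, Cross c)]) @ nested_caps))
            (conway ((u @ [(i, Cross c)]) @ crossed_caps c))"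
          using fib_consecutive_sym[OF nested_crossed(2)] first move[OF _ nested_crossed(1)]
            cross0_nested[of a a c] cross0_crossed[of a a c] by simp
      qed
    next
      case middle
      show ?thesis
      proof (rule fibonacci_tangleI1)
        show "tangle [] (u @ [(i, Cross c)]) [a, \<not> a, a, \<not> a]"
          using nested_crossed(1) middle by auto
        have "conway ((u @ [(i, Cross c)]) @ adjacent_caps) = conway (u @ crossed_caps c)"
          using middle by (simp add: crossed_caps_def)
        then show "fib_consecutive (conway ((u @ [(i, Cross c)]) @ adjacent_caps))
            (conway ((u @ [(i, Cross c)]) @ nested_caps))"
          using fib_consecutive_sym[OF nested_crossed(2)[of c]] middle
            move[OF _ nested_crossed(1)] cross1_nested[of a a c] by simp
      qed
    next
      case last
      show ?thesis
      proof (rule fibonacci_tangleI3)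
        show "tangle [] (u @ [(i, Cross c)]) [a, a, \<not> a, \<not> a]"
          using nested_crossed(1) last by (auto simp: numeral_2_eq_2)
        show "fib_consecutive (conway ((u @ [(i, Cross c)]) @ nested_caps))
            (conway ((u @ [(i, Cross c)]) @ crossed_caps c))"
          using fib_consecutive_sym[OF nested_crossed(2)] last move[OF _ nested_crossed(1)]
            cross2_nested[of a a c] cross2_crossed[of a a c] by simp
      qed
    qed
  qed
qed

lemma fibonacci_tangle_braid:
  assumes "fibonacci_tangle conway u" and "\<forall>(i, c) \<in> set braid. i < 3"
  shows "fibonacci_tangle conway (u @ map (\<lambda>(i, c). (i, Cross c)) braid)"
  using assms
proof (induction braid arbitrary: u)
  case Nil
  then show ?case by simp
next
  case (Cons x braid)
  obtain i c where x: "x = (i, c)" by (cases x)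
  have "fibonacci_tangle conway (u @ [(i, Cross c)])"
    using Cons.prems x by (intro fibonacci_tangle_cross) auto
  from Cons.IH[OF this] show ?case using Cons.prems(2) x by simp
qed


section \<open>Two minima\<close>

lemma conway_unknot: "conway [(0, Cup d), (0, Cap)] = 1"
proof (cases d)
  case True
  then show ?thesis using conway unfolding is_conway_polynomial_def unknot_def by simp
next
  case False
  have "isotopic ([] @ [(0, Cup True), (0, Cross True)] @ [(0, Cap)])
      ([] @ [(0, Cup (\<not> True))] @ [(0, Cap)])"
    by (rule isotopic.move[OF _ reidemeister1_cup]) auto
  moreover have "isotopic ([(0, Cup True)] @ [(0, Cross True), (0, Cap)] @ [])
      ([(0, Cup True)] @ [(0, Cap)] @ [])"
    by (rule isotopic.move[OF _ reidemeister1_cap]) auto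
  ultimately have "conway [(0, Cup False), (0, Cap)] = conway unknot"
    by (auto dest!: conway_isotopic simp: unknot_def)
  then show ?thesis using False conway unfolding is_conway_polynomial_def by simp
qed

lemma two_cups_crossed_caps:
  "conway ([(0, Cup d), (2, Cup (\<not> d))] @ crossed_caps c) = 1"
proof -
  have "isotopic ([(0, Cup d)] @ [(1, Cup (\<not> d)), (Suc 1, Cross (\<not> c))] @ adjacent_caps)
      ([(0, Cup d)] @ [(Suc 1, Cup (\<not> d)), (1, Cross (\<not> \<not> c))] @ adjacent_caps)"
    by (rule isotopic.move[OF _ slide_cup]) (auto simp: caps_defs)
  then have "conway ([(0, Cup d), (2, Cup (\<not> d))] @ crossed_caps c) =
      conway ([(0, Cup d), (1, Cup (\<not> d))] @ (2, Cross (\<not> c)) # adjacent_caps)"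
    by (auto dest!: conway_isotopic simp: crossed_caps_def numeral_2_eq_2)
  also have "\<dots> = conway ([(0, Cup d), (1, Cup (\<not> d))] @ adjacent_caps)"
    by (rule conway_closures[OF cross2_adjacent[of d d]]) auto
  also have "isotopic ([(0, Cup d)] @ [(Suc 0, Cup (\<not> d)), (0, Cap)] @ [(0, Cap)])
      ([(0, Cup d)] @ [] @ [(0, Cap)])"
    by (rule isotopic.move[OF _ zigzag_left]) auto
  then have "conway ([(0, Cup d), (1, Cup (\<not> d))] @ adjacent_caps) = conway [(0, Cup d), (0, Cap)]"
    by (auto dest!: conway_isotopic simp: adjacent_caps_def)
  finally show ?thesis by (simp add: conway_unknot)
qed

text \<open>Changing the crossing of \<open>crossed_caps\<close> turns an unknot into an unknot, so the skein relation
  gives the value 0 for the unlink.\<close>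

lemma fibonacci_tangle_opposite_cups:
  "fibonacci_tangle conway [(0, Cup d), (2, Cup (\<not> d))]" (is "fibonacci_tangle conway ?u")
proof (rule fibonacci_tangleI2)
  show t: "tangle [] ?u [d, \<not> d, \<not> d, d]" by (auto simp: numeral_2_eq_2)
  have "conway (?u @ crossed_caps True) - conway (?u @ crossed_caps False) =
      [:0, 1:] * conway (?u @ adjacent_caps)"
    using conway_parallel_crossing[of ?u "[d]" "\<not> d" "[d]" adjacent_caps] t
    by (simp add: caps_defs)
  then have "conway (?u @ adjacent_caps) = 0"
    unfolding two_cups_crossed_caps by simp
  then show "fib_consecutive (conway (?u @ adjacent_caps)) (conway (?u @ crossed_caps True))"
    unfolding two_cups_crossed_caps by (simp add: fib_consecutive_0_1)
qed

text \<open>Minima of equal direction are reached from opposite ones by a kink in one of them.\<close>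

lemma fibonacci_tangle_cups: "fibonacci_tangle conway [(0, Cup d), (2, Cup e)]"
proof (cases "e = d")
  case False
  then have "e = (\<not> d)" by blast
  then show ?thesis using fibonacci_tangle_opposite_cups by simp
next
  case True
  let ?u = "[(0, Cup d), (2, Cup (\<not> d))]"
  have t: "tangle [] [(0, Cup d), (2, Cup d)] [d, \<not> d, d, \<not> d]" by (simp add: numeral_2_eq_2)
  have kink: "conway ((?u @ [(2, Cross True)]) @ v) = conway ([(0, Cup d), (2, Cup d)] @ v)"
    if "tangle [d, \<not> d, d, \<not> d] v []" for v
  proof -
    have "isotopic ([(0, Cup d)] @ [(2, Cup (\<not> d)), (2, Cross True)] @ v)
        ([(0, Cup d)] @ [(2, Cup (\<not> \<not> d))] @ v)"
      by (rule isotopic.move[OF _ reidemeister1_cup _ _ that]) (auto simp: numeral_2_eq_2)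
    then show ?thesis by (auto dest!: conway_isotopic)
  qed
  have "fibonacci_tangle conway (?u @ [(2, Cross True)])"
    using fibonacci_tangle_opposite_cups by (rule fibonacci_tangle_cross) simp
  moreover have "tangle [] (?u @ [(2, Cross True)]) [d, \<not> d, d, \<not> d]"
    by (auto simp: numeral_2_eq_2)
  ultimately have "fib_consecutive (conway ((?u @ [(2, Cross True)]) @ adjacent_caps))
      (conway ((?u @ [(2, Cross True)]) @ nested_caps))"
    unfolding fibonacci_tangle_def by (auto simp: numeral_2_eq_2)
  moreover have "tangle [d, \<not> d, d, \<not> d] adjacent_caps []" "tangle [d, \<not> d, d, \<not> d] nested_caps []"
    by (simp_all add: caps_defs)
  ultimately show ?thesis
    using True kink t by (intro fibonacci_tangleI1) simp_all
qed

lemma conway_four_plat: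
  assumes "\<forall>(i, c) \<in> set braid. i < 3" and "link_diagram (four_plat d e braid)"
  shows "\<exists>j. 2 dvd conway (four_plat d e braid) - fib_poly j"
proof -
  define u where "u = [(0, Cup d), (2, Cup e)] @ map (\<lambda>(i, c). (i, Cross c)) braid"
  have plat: "four_plat d e braid = u @ adjacent_caps"
    by (simp add: four_plat_def u_def adjacent_caps_def)
  have fib: "fibonacci_tangle conway u"
    unfolding u_def using fibonacci_tangle_cups assms(1) by (rule fibonacci_tangle_braid)
  \<comment> \<open>The orientation excludes the position in which the two left ends are parallel.\<close>
  have "\<not> tangle [] u [a, a, \<not> a, \<not> a]" for a
  proof
    assume "tangle [] u [a, a, \<not> a, \<not> a]"
    moreover obtain s where "tangle [] u s" "tangle s adjacent_caps []"
      using assms(2) unfolding plat link_diagram_def by auto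
    ultimately have "tangle [a, a, \<not> a, \<not> a] adjacent_caps []" by (metis tangle_unique)
    then show False by (simp add: adjacent_caps_def)
  qed
  then obtain q where "fib_consecutive (conway (u @ adjacent_caps)) q"
    using fib unfolding fibonacci_tangle_def by blast
  then show ?thesis unfolding plat fib_consecutive_def by blast
qed

end

theorem theorem3p3:
  fixes conway :: "diagram \<Rightarrow> int poly" and L :: diagram
  assumes "is_conway_polynomial conway"
    and "two_bridge L"
  shows "\<exists>d::int. \<forall>k. [coeff (conway L) k = coeff (fib_poly d) k] (mod 2)"
proof -
  obtain d e braid where braid: "\<forall>(i, c) \<in> set braid. i < 3"
    and iso: "isotopic L (four_plat d e braid)"
    using assms(2) unfolding two_bridge_def by blast
  have "link_diagram (four_plat d e braid)"
    using isotopic_link_diagram[OF iso] by blast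
  then obtain j where "2 dvd conway (four_plat d e braid) - fib_poly j"
    using conway_four_plat[OF assms(1) braid] by blast
  then have "[:2:] dvd conway L - fib_poly j"
    using conway_isotopic[OF assms(1) iso] by (simp add: numeral_poly)
  then have "\<forall>k. [coeff (conway L) k = coeff (fib_poly j) k] (mod 2)"
    by (simp add: const_poly_dvd_iff cong_iff_dvd_diff)
  then show ?thesis by blast
qed

end
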